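(* The mixing time of the logit dynamics for the XOR game is $\Omega(e^\beta)$: there exists a constant $C>0$ such that for every $n\ge 2$ and every $\beta\ge 0$, the mixing time $t_{\mathrm{mix}}$ of the logit dynamics with inverse noise $\beta$ for the $n$-player XOR game satisfies $t_{\mathrm{mix}}\ge C e^{\beta}$.
   Context: XOR game: $n$ players, each with strategy set $\{0,1\}$; for every player $i$, $u_i(\mathbf{x})=-1$ if $\mathbf{x}$ has an odd number of $1$'s and $u_i(\mathbf{x})=0$ if $\mathbf{x}$ has an even number of $1$'s. Logit dynamics: for a strategic game with $n$ players, finite strategy sets $S_i$ and utilities $u_i:\prod_j S_j\to\mathbb{R}$, and for $\beta\ge 0$, let $\sigma_i(y\mid\mathbf{x})=e^{\beta u_i(\mathbf{x}_{-i},y)}/\sum_{z\in S_i}e^{\beta u_i(\mathbf{x}_{-i},z)}$, where $(\mathbf{x}_{-i},y)$ is $\mathbf{x}$ with its $i$-th entry replaced by $y$. The logit dynamics with inverse noise $\beta$ is the Markov chain on $\Omega=\prod_j S_j$ which, from profile $\mathbf{x}$, selects a player $i$ uniformly at random and replaces $x_i$ by $y\in S_i$ with probability $\sigma_i(y\mid\mathbf{x})$. It is irreducible and aperiodic; let $P$ be its transition matrix and $\pi$ its unique stationary distribution. The mixing time is $t_{\mathrm{mix}}=\min\{t\in\mathbb{N}:\max_{\mathbf{x}\in\Omega}\|P^t(\mathbf{x},\cdot)-\pi\|_{\mathrm{TV}}\le 1/4\}$, where $\|\mu-\nu\|_{\mathrm{TV}}=\max_{A\subseteq\Omega}|\mu(A)-\nu(A)|$.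 *)

theory Defs
  imports "HOL-Probability.Probability"
begin

section \<open>Finite Markov chains\<close>

text \<open>A chain on a finite state set \<open>\<Omega>\<close> is given by its kernel \<open>K\<close>: row \<open>x\<close> of the transition
  matrix is the distribution \<open>K x\<close>, and \<open>kernel_power K t x\<close> is the row \<open>x\<close> of its \<open>t\<close>-th power.\<close>

primrec kernel_power :: "('a \<Rightarrow> 'a pmf) \<Rightarrow> nat \<Rightarrow> 'a \<Rightarrow> 'a pmf" where
  "kernel_power K 0 = return_pmf"
| "kernel_power K (Suc t) = (\<lambda>x. bind_pmf (kernel_power K t x) K)"

text \<open>The support condition matters: \<open>\<Omega>\<close> is a proper subset of its type in the application below,
  and the kernel may have further stationary distributions outside \<open>\<Omega>\<close>.\<close>

definition is_stationary :: "'a set \<Rightarrow> ('a \<Rightarrow> 'a pmf) \<Rightarrow> 'a pmf \<Rightarrow> bool" where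
  "is_stationary \<Omega> K \<pi> \<longleftrightarrow> set_pmf \<pi> \<subseteq> \<Omega> \<and> bind_pmf \<pi> K = \<pi>"

definition stationary_distribution :: "'a set \<Rightarrow> ('a \<Rightarrow> 'a pmf) \<Rightarrow> 'a pmf" where
  "stationary_distribution \<Omega> K = (THE \<pi>. is_stationary \<Omega> K \<pi>)"

definition tv_distance :: "'a set \<Rightarrow> 'a pmf \<Rightarrow> 'a pmf \<Rightarrow> real" where
  "tv_distance \<Omega> \<mu> \<nu> =
     (MAX A\<in>Pow \<Omega>. \<bar>measure_pmf.prob \<mu> A - measure_pmf.prob \<nu> A\<bar>)"

definition mixing_time :: "'a set \<Rightarrow> ('a \<Rightarrow> 'a pmf) \<Rightarrow> nat" where
  "mixing_time \<Omega> K =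
     (LEAST t. (MAX x\<in>\<Omega>. tv_distance \<Omega> (kernel_power K t x) (stationary_distribution \<Omega> K)) \<le> 1 / 4)"

section \<open>Logit dynamics of a strategic game\<close>

text \<open>The players of an \<open>n\<close>-player game are \<open>0, \<dots>, n - 1\<close>; \<open>S i\<close> is the strategy set and \<open>u i\<close> the
  utility of player \<open>i\<close>. Profiles are extensional functions, so there are exactly
  \<open>\<Prod>i<n. card (S i)\<close> of them.\<close>

definition profiles :: "nat \<Rightarrow> (nat \<Rightarrow> 's set) \<Rightarrow> (nat \<Rightarrow> 's) set" where
  "profiles n S = (\<Pi>\<^sub>E i\<in>{..<n}. S i)"

definition logit_prob ::
  "(nat \<Rightarrow> 's set) \<Rightarrow> (nat \<Rightarrow> (nat \<Rightarrow> 's) \<Rightarrow> real) \<Rightarrow> real \<Rightarrow> nat \<Rightarrow> (nat \<Rightarrow> 's) \<Rightarrow> 's \<Rightarrow> real" where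
  "logit_prob S u \<beta> i x y =
     exp (\<beta> * u i (x(i := y))) / (\<Sum>z\<in>S i. exp (\<beta> * u i (x(i := z))))"

definition logit_choice ::
  "(nat \<Rightarrow> 's set) \<Rightarrow> (nat \<Rightarrow> (nat \<Rightarrow> 's) \<Rightarrow> real) \<Rightarrow> real \<Rightarrow> nat \<Rightarrow> (nat \<Rightarrow> 's) \<Rightarrow> 's pmf" where
  "logit_choice S u \<beta> i x = embed_pmf (\<lambda>y. if y \<in> S i then logit_prob S u \<beta> i x y else 0)"

lemma pmf_logit_choice:
  assumes "finite (S i)" "S i \<noteq> {}"
  shows "pmf (logit_choice S u \<beta> i x) y = (if y \<in> S i then logit_prob S u \<beta> i x y else 0)"
proof -
  let ?f = "\<lambda>y. if y \<in> S i then logit_prob S u \<beta> i x y else 0"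
  have pos: "(\<Sum>z\<in>S i. exp (\<beta> * u i (x(i := z)))) > 0"
    using assms by (intro sum_pos) auto
  have nn: "logit_prob S u \<beta> i x y \<ge> 0" for y
    using pos by (simp add: logit_prob_def)
  have "(\<Sum>y\<in>S i. logit_prob S u \<beta> i x y) = 1"
    using pos by (simp add: logit_prob_def flip: sum_divide_distrib)
  hence "(\<Sum>y\<in>S i. ennreal (?f y)) = 1"
    using nn by (subst sum_ennreal) auto
  moreover have "(\<integral>\<^sup>+ y. ennreal (?f y) \<partial>count_space UNIV) = (\<Sum>y\<in>S i. ennreal (?f y))"
    using assms by (intro nn_integral_count_space') auto
  ultimately show ?thesis
    unfolding logit_choice_def using nn by (subst pmf_embed_pmf) auto
qed

definition logit_dynamics ::
  "nat \<Rightarrow> (nat \<Rightarrow> 's set) \<Rightarrow> (nat \<Rightarrow> (nat \<Rightarrow> 's) \<Rightarrow> real) \<Rightarrow> real \<Rightarrow> (nat \<Rightarrow> 's) \<Rightarrow> (nat \<Rightarrow> 's) pmf" where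
  "logit_dynamics n S u \<beta> x =
     do {
       i \<leftarrow> pmf_of_set {..<n};
       y \<leftarrow> logit_choice S u \<beta> i x;
       return_pmf (x(i := y))
     }"

definition logit_mixing_time ::
  "nat \<Rightarrow> (nat \<Rightarrow> 's set) \<Rightarrow> (nat \<Rightarrow> (nat \<Rightarrow> 's) \<Rightarrow> real) \<Rightarrow> real \<Rightarrow> nat" where
  "logit_mixing_time n S u \<beta> = mixing_time (profiles n S) (logit_dynamics n S u \<beta>)"

section \<open>The XOR game\<close>

definition xor_strategies :: "nat \<Rightarrow> nat set" where
  "xor_strategies i = {0, 1}"

definition xor_utility :: "nat \<Rightarrow> nat \<Rightarrow> (nat \<Rightarrow> nat) \<Rightarrow> real" where
  "xor_utility n i x = (if odd (card {j\<in>{..<n}. x j = 1}) then -1 else 0)"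

end

theory Submission
  imports Defs
begin

text \<open>For two profiles with an even number of ones the chain stays put with probability at least
  \<open>1 - p\<close> in each step, where \<open>p = 1 / (1 + exp \<beta>)\<close>, whatever \<open>n\<close> is. If both rows
  after \<open>t\<close> steps are within \<open>1/4\<close> of a common distribution \<open>\<pi>\<close>, they are within \<open>1/2\<close>
  of each other, and comparing them on a singleton gives \<open>(1 - t p) - t p \<le> 1/2\<close>, that is,
  \<open>t \<ge> (1 + exp \<beta>) / 4\<close>. Nothing about \<open>\<pi>\<close> is used here except that the chain
  converges to it. Convergence is Doeblin's theorem: after \<open>n\<close> steps all profiles are reachable,
  so the spread of every column of the transition matrix contracts geometrically.\<close>

section \<open>Doeblin's theorem for finite kernels\<close>

lemma prob_bind_pmf:
  "measure_pmf.prob (bind_pmf p f) A = measure_pmf.expectation p (\<lambda>x. measure_pmf.prob (f x) A)"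
proof -
  have int: "integrable (measure_pmf p) (\<lambda>x. measure_pmf.prob (f x) A)"
    by (rule measure_pmf.integrable_const_bound[where B=1]) auto
  have "ennreal (measure_pmf.prob (bind_pmf p f) A) = (\<integral>\<^sup>+x. ennreal (measure_pmf.prob (f x) A) \<partial>p)"
    by (simp flip: measure_pmf.emeasure_eq_measure)
  also have "\<dots> = ennreal (measure_pmf.expectation p (\<lambda>x. measure_pmf.prob (f x) A))"
    by (intro nn_integral_eq_integral int) auto
  finally show ?thesis by simp
qed

lemma prob_bind_pmf_finite:
  assumes "finite \<Omega>" "set_pmf p \<subseteq> \<Omega>"
  shows "measure_pmf.prob (bind_pmf p f) A = (\<Sum>z\<in>\<Omega>. measure_pmf.prob (f z) A * pmf p z)"
  unfolding prob_bind_pmf using assms by (intro integral_measure_pmf_real) auto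

text \<open>Passing through the single intermediate state \<open>z\<close> is one of the ways to
  arrive at \<open>w\<close>.\<close>

lemma pmf_mult_le_pmf_bind: "pmf p z * pmf (f z) w \<le> pmf (bind_pmf p f) w"
proof -
  have "pmf p z * pmf (f z) w = measure_pmf.expectation p (\<lambda>x. indicator {z} x * pmf (f z) w)"
    by (simp add: measure_pmf_single)
  also have "\<dots> \<le> measure_pmf.expectation p (\<lambda>x. pmf (f x) w)"
    by (intro integral_mono measure_pmf.integrable_const_bound[where B=1])
       (auto simp: indicator_def pmf_le_1 split: if_splits)
  finally show ?thesis by (simp add: pmf_bind)
qed

lemma kernel_power_add:
  "kernel_power K (s + t) x = bind_pmf (kernel_power K s x) (kernel_power K t)"
  by (induction t) (simp_all add: bind_return_pmf' bind_assoc_pmf)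

text \<open>Never leaving \<open>x\<close> is one of the ways to be at \<open>x\<close> after
  \<open>t\<close> steps.\<close>

lemma power_pmf_self_le_kernel_power: "pmf (K x) x ^ t \<le> pmf (kernel_power K t x) x"
proof (induction t)
  case (Suc t)
  have "pmf (K x) x ^ Suc t \<le> pmf (kernel_power K t x) x * pmf (K x) x"
    using Suc by (simp add: mult.commute mult_left_mono)
  also have "\<dots> \<le> pmf (kernel_power K (Suc t) x) x"
    using pmf_mult_le_pmf_bind[of "kernel_power K t x" x K x] by simp
  finally show ?case .
qed simp

section \<open>Geometric contraction of columns\<close>

text \<open>Removing the common amount \<open>\<delta>\<close> from both weightings cancels in the
  difference and leaves nonnegative weights of total mass
  \<open>1 - card \<Omega> * \<delta>\<close>; only these see the variation of \<open>g\<close>. In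
  the application \<open>a\<close> and \<open>b\<close> are rows of the \<open>m\<close>-step matrix
  and \<open>g\<close> is the probability of an event as a function of the starting state.\<close>

lemma weighted_sum_diff_le:
  fixes g a b :: "'a \<Rightarrow> real" and c \<delta> :: real
  assumes fin: "finite \<Omega>" "\<Omega> \<noteq> {}"
    and a: "sum a \<Omega> = 1" "\<And>z. z \<in> \<Omega> \<Longrightarrow> \<delta> \<le> a z"
    and b: "sum b \<Omega> = 1" "\<And>z. z \<in> \<Omega> \<Longrightarrow> \<delta> \<le> b z"
    and g: "\<And>x y. x \<in> \<Omega> \<Longrightarrow> y \<in> \<Omega> \<Longrightarrow> g x - g y \<le> c"
  shows "(\<Sum>z\<in>\<Omega>. g z * a z) - (\<Sum>z\<in>\<Omega>. g z * b z) \<le> (1 - card \<Omega> * \<delta>) * c"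
proof -
  let ?M = "Max (g ` \<Omega>)" and ?m = "Min (g ` \<Omega>)"
  have "?M \<in> g ` \<Omega>" "?m \<in> g ` \<Omega>"
    using fin by (auto intro!: Max_in Min_in)
  then have Mm: "?M - ?m \<le> c"
    using g by auto
  have "card \<Omega> * \<delta> \<le> sum a \<Omega>"
    using sum_mono[of \<Omega> "\<lambda>_. \<delta>" a] a by simp
  then have w: "0 \<le> 1 - card \<Omega> * \<delta>"
    using a by simp
  have "(\<Sum>z\<in>\<Omega>. g z * a z) - (\<Sum>z\<in>\<Omega>. g z * b z)
      = (\<Sum>z\<in>\<Omega>. g z * (a z - \<delta>)) - (\<Sum>z\<in>\<Omega>. g z * (b z - \<delta>))"
    by (simp add: algebra_simps sum_subtractf)
  also have "\<dots> \<le> (\<Sum>z\<in>\<Omega>. ?M * (a z - \<delta>)) - (\<Sum>z\<in>\<Omega>. ?m * (b z - \<delta>))"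
    using fin a b by (intro diff_mono sum_mono mult_right_mono) auto
  also have "\<dots> = (1 - card \<Omega> * \<delta>) * (?M - ?m)"
    unfolding sum_distrib_left[symmetric] sum_subtractf using a b
    by (simp add: algebra_simps)
  also have "\<dots> \<le> (1 - card \<Omega> * \<delta>) * c"
    using w Mm by (rule mult_left_mono[rotated])
  finally show ?thesis .
qed

text \<open>A single exponent \<open>m\<close> serving all pairs of states encodes irreducibility
  and aperiodicity together.\<close>

locale primitive_kernel =
  fixes \<Omega> :: "'a set" and K :: "'a \<Rightarrow> 'a pmf" and m :: nat
  assumes finite_states: "finite \<Omega>"
    and states_nonempty: "\<Omega> \<noteq> {}"
    and closed: "x \<in> \<Omega> \<Longrightarrow> set_pmf (K x) \<subseteq> \<Omega>"
    and reachable: "x \<in> \<Omega> \<Longrightarrow> y \<in> \<Omega> \<Longrightarrow> y \<in> set_pmf (kernel_power K m x)"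
begin

lemma set_pmf_kernel_power: "x \<in> \<Omega> \<Longrightarrow> set_pmf (kernel_power K t x) \<subseteq> \<Omega>"
  using closed by (induction t) auto

text \<open>Doeblin's minorisation: the entries of the \<open>m\<close>-step matrix on the finite
  set \<open>\<Omega>\<close> have a positive minimum \<open>\<delta>\<close>, so every block of
  \<open>m\<close> steps shrinks the spread by the factor
  \<open>1 - card \<Omega> * \<delta>\<close>. The rate \<open>c\<close> is uniform in the event and
  in the states.\<close>

lemma geometric_contraction:
  obtains c :: real where "0 \<le> c" "c < 1"
    "\<And>k A x y. x \<in> \<Omega> \<Longrightarrow> y \<in> \<Omega> \<Longrightarrow>
      measure_pmf.prob (kernel_power K (m * k) x) A
        - measure_pmf.prob (kernel_power K (m * k) y) A \<le> c ^ k"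
proof -
  let ?E = "(\<lambda>(x, y). pmf (kernel_power K m x) y) ` (\<Omega> \<times> \<Omega>)"
  define \<delta> where "\<delta> = Min ?E"
  have E: "finite ?E" "?E \<noteq> {}"
    using finite_states states_nonempty by auto
  have pos: "\<delta> > 0"
    unfolding \<delta>_def using E reachable by (auto simp: Min_gr_iff pmf_positive)
  have le: "\<delta> \<le> pmf (kernel_power K m x) y" if "x \<in> \<Omega>" "y \<in> \<Omega>" for x y
    unfolding \<delta>_def using E that by (intro Min_le) auto
  have sum1: "(\<Sum>z\<in>\<Omega>. pmf (kernel_power K m x) z) = 1" if "x \<in> \<Omega>" for x
    using that finite_states set_pmf_kernel_power by (intro sum_pmf_eq_1) auto
  define c where "c = 1 - card \<Omega> * \<delta>"
  obtain x0 where x0: "x0 \<in> \<Omega>"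
    using states_nonempty by auto
  have "card \<Omega> * \<delta> \<le> 1"
    using sum_mono[of \<Omega> "\<lambda>_. \<delta>" "pmf (kernel_power K m x0)"] le[OF x0] sum1[OF x0] by simp
  then have "0 \<le> c"
    by (simp add: c_def)
  moreover have "c < 1"
    using pos finite_states states_nonempty by (simp add: c_def card_gt_0_iff)
  moreover have "measure_pmf.prob (kernel_power K (m * k) x) A
      - measure_pmf.prob (kernel_power K (m * k) y) A \<le> c ^ k" if "x \<in> \<Omega>" "y \<in> \<Omega>" for k A x y
    using that
  proof (induction k arbitrary: x y)
    case 0
    have "measure_pmf.prob p A - measure_pmf.prob q A \<le> 1" for p q :: "'a pmf"
      using measure_pmf.prob_le_1[of p A] measure_nonneg[of q A] by linarith
    then show ?case by (metis power_0)
  next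
    case (Suc k)
    \<comment> \<open>The first \<open>m\<close> steps are split off: their row supplies the
      weights, and the remaining \<open>m * k\<close> steps supply the function to which the
      induction hypothesis applies.\<close>
    have step: "measure_pmf.prob (kernel_power K (m * Suc k) z) A
        = (\<Sum>w\<in>\<Omega>. measure_pmf.prob (kernel_power K (m * k) w) A * pmf (kernel_power K m z) w)"
      if "z \<in> \<Omega>" for z
      using prob_bind_pmf_finite[OF finite_states set_pmf_kernel_power[OF that]]
      by (simp only: mult_Suc_right kernel_power_add)
    have "measure_pmf.prob (kernel_power K (m * Suc k) x) A
        - measure_pmf.prob (kernel_power K (m * Suc k) y) A \<le> (1 - card \<Omega> * \<delta>) * c ^ k"
      unfolding step[OF Suc.prems(1)] step[OF Suc.prems(2)]
      using Suc.prems
      by (intro weighted_sum_diff_le finite_states states_nonempty sum1 le Suc.IH)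
    then show ?case by (simp add: c_def)
  qed
  ultimately show thesis by (rule that)
qed

text \<open>Averages the contraction over a second starting state drawn from \<open>\<mu>\<close>. A
  stationary \<open>\<mu>\<close> gives convergence to it; the law of the chain at an earlier time
  as \<open>\<mu>\<close> gives the Cauchy property.\<close>

lemma geometric_mixing:
  obtains c :: real where "0 \<le> c" "c < 1"
    "\<And>k A x \<mu>. x \<in> \<Omega> \<Longrightarrow> set_pmf \<mu> \<subseteq> \<Omega> \<Longrightarrow>
      \<bar>measure_pmf.prob (kernel_power K (m * k) x) A
        - measure_pmf.prob (bind_pmf \<mu> (kernel_power K (m * k))) A\<bar> \<le> c ^ k"
proof -
  obtain c :: real where c: "0 \<le> c" "c < 1"
    "\<And>k A x y. x \<in> \<Omega> \<Longrightarrow> y \<in> \<Omega> \<Longrightarrow>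
      measure_pmf.prob (kernel_power K (m * k) x) A
        - measure_pmf.prob (kernel_power K (m * k) y) A \<le> c ^ k"
    by (rule geometric_contraction) (use that in blast)
  have "\<bar>measure_pmf.prob (kernel_power K (m * k) x) A
        - measure_pmf.prob (bind_pmf \<mu> (kernel_power K (m * k))) A\<bar> \<le> c ^ k"
    if x: "x \<in> \<Omega>" and \<mu>: "set_pmf \<mu> \<subseteq> \<Omega>" for k A x \<mu>
  proof -
    let ?P = "\<lambda>z. measure_pmf.prob (kernel_power K (m * k) z) A"
    have sum1: "(\<Sum>z\<in>\<Omega>. pmf \<mu> z) = 1"
      using \<mu> finite_states by (intro sum_pmf_eq_1)
    have "?P x - measure_pmf.prob (bind_pmf \<mu> (kernel_power K (m * k))) A
        = (\<Sum>z\<in>\<Omega>. (?P x - ?P z) * pmf \<mu> z)"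
      using sum1 by (simp add: prob_bind_pmf_finite[OF finite_states \<mu>] left_diff_distrib
          sum_subtractf flip: sum_distrib_left)
    also have "\<bar>\<dots>\<bar> \<le> (\<Sum>z\<in>\<Omega>. c ^ k * pmf \<mu> z)"
    proof (rule order.trans[OF sum_abs], rule sum_mono)
      fix z assume "z \<in> \<Omega>"
      then have "\<bar>?P x - ?P z\<bar> \<le> c ^ k"
        using c(3)[OF x, of z] c(3)[OF _ x, of z] by (simp add: abs_le_iff)
      then show "\<bar>(?P x - ?P z) * pmf \<mu> z\<bar> \<le> c ^ k * pmf \<mu> z"
        by (simp add: abs_mult mult_right_mono)
    qed
    also have "\<dots> = c ^ k"
      using sum1 by (simp flip: sum_distrib_left)
    finally show ?thesis .
  qed
  with c show thesis using that by blast
qed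

section \<open>Existence and uniqueness of the stationary distribution\<close>

lemma bind_stationary_kernel_power:
  assumes "is_stationary \<Omega> K \<pi>"
  shows "bind_pmf \<pi> (kernel_power K t) = \<pi>"
proof (induction t)
  case (Suc t)
  have "bind_pmf \<pi> (kernel_power K (Suc t)) = bind_pmf (bind_pmf \<pi> (kernel_power K t)) K"
    by (simp add: bind_assoc_pmf)
  with Suc assms show ?case
    by (simp add: is_stationary_def)
qed (simp add: bind_return_pmf')

text \<open>From one fixed start, the laws at the times \<open>m * k\<close> converge to every
  stationary distribution, and limits are unique.\<close>

lemma stationary_unique:
  assumes "is_stationary \<Omega> K \<pi>" "is_stationary \<Omega> K \<rho>"
  shows "\<pi> = \<rho>"
proof (rule pmf_eqI)
  fix y
  obtain c :: real where c: "0 \<le> c" "c < 1"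
    "\<And>k A x \<mu>. x \<in> \<Omega> \<Longrightarrow> set_pmf \<mu> \<subseteq> \<Omega> \<Longrightarrow>
      \<bar>measure_pmf.prob (kernel_power K (m * k) x) A
        - measure_pmf.prob (bind_pmf \<mu> (kernel_power K (m * k))) A\<bar> \<le> c ^ k"
    by (rule geometric_mixing) (use that in blast)
  obtain x where x: "x \<in> \<Omega>"
    using states_nonempty by auto
  have lim: "(\<lambda>k. pmf (kernel_power K (m * k) x) y) \<longlonglongrightarrow> pmf \<tau> y"
    if "is_stationary \<Omega> K \<tau>" for \<tau>
  proof (rule Lim_transform[OF tendsto_const], rule Lim_null_comparison)
    show "\<forall>\<^sub>F k in sequentially. norm (pmf (kernel_power K (m * k) x) y - pmf \<tau> y) \<le> c ^ k"
      using c(3)[OF x, of \<tau> _ "{y}"] that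
      by (auto simp: bind_stationary_kernel_power measure_pmf_single is_stationary_def)
    show "(\<lambda>k. c ^ k) \<longlonglongrightarrow> 0"
      using c by (intro LIMSEQ_power_zero) auto
  qed
  show "pmf \<pi> y = pmf \<rho> y"
    using lim[OF assms(1)] lim[OF assms(2)] by (rule LIMSEQ_unique)
qed

text \<open>The law \<open>p t\<close> from a fixed start is Cauchy in every coordinate. Since
  \<open>\<Omega>\<close> is finite, limits pass through sums over it: the limit has total mass 1,
  and the one-step recursion becomes stationarity.\<close>

lemma stationary_exists: "\<exists>\<pi>. is_stationary \<Omega> K \<pi>"
proof -
  obtain c :: real where c: "0 \<le> c" "c < 1"
    "\<And>k A x \<mu>. x \<in> \<Omega> \<Longrightarrow> set_pmf \<mu> \<subseteq> \<Omega> \<Longrightarrow>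
      \<bar>measure_pmf.prob (kernel_power K (m * k) x) A
        - measure_pmf.prob (bind_pmf \<mu> (kernel_power K (m * k))) A\<bar> \<le> c ^ k"
    by (rule geometric_mixing) (use that in blast)
  obtain x where x: "x \<in> \<Omega>"
    using states_nonempty by auto
  define p where "p t = kernel_power K t x" for t
  have near: "\<bar>pmf (p (m * k)) y - pmf (p t) y\<bar> \<le> c ^ k" if "m * k \<le> t" for k t y
  proof -
    \<comment> \<open>Here the last \<open>m * k\<close> steps are split off, so that
      \<open>p t\<close> is the \<open>m * k\<close>-step law with random start
      \<open>p (t - m * k)\<close>.\<close>
    have "p t = bind_pmf (p (t - m * k)) (kernel_power K (m * k))"
      using that by (simp add: p_def flip: kernel_power_add)
    then show ?thesis
      using c(3)[OF x, of "p (t - m * k)" k "{y}"] set_pmf_kernel_power[OF x]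
      by (simp add: p_def measure_pmf_single)
  qed
  have "Cauchy (\<lambda>t. pmf (p t) y)" for y
  proof (rule metric_CauchyI)
    fix e :: real assume "e > 0"
    then obtain k where k: "c ^ k < e / 2"
      using real_arch_pow_inv[of "e / 2" c] c by auto
    show "\<exists>M. \<forall>s\<ge>M. \<forall>t\<ge>M. dist (pmf (p s) y) (pmf (p t) y) < e"
    proof (intro exI allI impI)
      fix s t assume "s \<ge> m * k" "t \<ge> m * k"
      then show "dist (pmf (p s) y) (pmf (p t) y) < e"
        using near[of k s y] near[of k t y] k by (auto simp: dist_real_def)
    qed
  qed
  then have "\<exists>q. (\<lambda>t. pmf (p t) y) \<longlonglongrightarrow> q" for y
    by (metis Cauchy_convergent convergentD)
  then obtain q where q: "\<And>y. (\<lambda>t. pmf (p t) y) \<longlonglongrightarrow> q y"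
    by metis
  have q_nonneg: "q y \<ge> 0" for y
    by (rule LIMSEQ_le_const[OF q]) auto
  have q_outside: "q y = 0" if "y \<notin> \<Omega>" for y
  proof -
    have "pmf (p t) y = 0" for t
      using set_pmf_kernel_power[OF x, of t] that by (auto simp: p_def pmf_eq_0_set_pmf)
    then show ?thesis
      using q[of y] by (simp add: LIMSEQ_const_iff)
  qed
  have "(\<lambda>t. \<Sum>y\<in>\<Omega>. pmf (p t) y) \<longlonglongrightarrow> (\<Sum>y\<in>\<Omega>. q y)"
    by (intro tendsto_sum q)
  moreover have "(\<Sum>y\<in>\<Omega>. pmf (p t) y) = 1" for t
    using set_pmf_kernel_power[OF x] finite_states by (intro sum_pmf_eq_1) (auto simp: p_def)
  ultimately have q_sum: "(\<Sum>y\<in>\<Omega>. q y) = 1"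
    by (simp add: LIMSEQ_const_iff)
  have "(\<integral>\<^sup>+ y. ennreal (q y) \<partial>count_space UNIV) = (\<Sum>y\<in>\<Omega>. ennreal (q y))"
    using finite_states q_outside by (intro nn_integral_count_space') auto
  also have "\<dots> = 1"
    using q_sum q_nonneg by (simp add: sum_ennreal)
  finally have pmf_\<pi>: "pmf (embed_pmf q) y = q y" for y
    using q_nonneg by (intro pmf_embed_pmf)
  have supp: "set_pmf (embed_pmf q) \<subseteq> \<Omega>"
    using q_outside by (metis pmf_\<pi> set_pmf_iff subsetI)
  have "bind_pmf (embed_pmf q) K = embed_pmf q"
  proof (rule pmf_eqI)
    fix y
    have "(\<lambda>t. \<Sum>z\<in>\<Omega>. pmf (K z) y * pmf (p t) z) \<longlonglongrightarrow> (\<Sum>z\<in>\<Omega>. pmf (K z) y * q z)"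
      by (intro tendsto_intros q)
    moreover have "(\<Sum>z\<in>\<Omega>. pmf (K z) y * pmf (p t) z) = pmf (p (Suc t)) y" for t
      using prob_bind_pmf_finite[OF finite_states set_pmf_kernel_power[OF x], of t K "{y}"]
      by (simp add: p_def measure_pmf_single)
    moreover have "(\<Sum>z\<in>\<Omega>. pmf (K z) y * q z) = pmf (bind_pmf (embed_pmf q) K) y"
      using prob_bind_pmf_finite[OF finite_states supp, of K "{y}"]
      by (simp add: pmf_\<pi> measure_pmf_single)
    ultimately have "(\<lambda>t. pmf (p (Suc t)) y) \<longlonglongrightarrow> pmf (bind_pmf (embed_pmf q) K) y"
      by simp
    then show "pmf (bind_pmf (embed_pmf q) K) y = pmf (embed_pmf q) y"
      using LIMSEQ_Suc[OF q[of y]] LIMSEQ_unique by (simp add: pmf_\<pi>) blast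
  qed
  with supp show ?thesis
    unfolding is_stationary_def by blast
qed

lemma is_stationary_stationary_distribution:
  "is_stationary \<Omega> K (stationary_distribution \<Omega> K)"
  unfolding stationary_distribution_def
  by (rule theI') (use stationary_exists stationary_unique in blast)

section \<open>Mixing time and holding probabilities\<close>

text \<open>A \<open>LEAST\<close> has its defining property only if some number has it; the time
  \<open>m * k\<close> with \<open>c ^ k < 1 / 4\<close> is such a witness.\<close>

lemma tv_distance_mixing_time_le:
  assumes "x \<in> \<Omega>"
  shows "tv_distance \<Omega> (kernel_power K (mixing_time \<Omega> K) x) (stationary_distribution \<Omega> K) \<le> 1 / 4"
proof -
  let ?\<pi> = "stationary_distribution \<Omega> K"
  let ?d = "\<lambda>t. MAX x\<in>\<Omega>. tv_distance \<Omega> (kernel_power K t x) ?\<pi>"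
  obtain c :: real where c: "0 \<le> c" "c < 1"
    "\<And>k A x \<mu>. x \<in> \<Omega> \<Longrightarrow> set_pmf \<mu> \<subseteq> \<Omega> \<Longrightarrow>
      \<bar>measure_pmf.prob (kernel_power K (m * k) x) A
        - measure_pmf.prob (bind_pmf \<mu> (kernel_power K (m * k))) A\<bar> \<le> c ^ k"
    by (rule geometric_mixing) (use that in blast)
  obtain k where k: "c ^ k < 1 / 4"
    using real_arch_pow_inv[of "1 / 4" c] c by auto
  have "set_pmf ?\<pi> \<subseteq> \<Omega>"
    using is_stationary_stationary_distribution by (simp add: is_stationary_def)
  then have "\<bar>measure_pmf.prob (kernel_power K (m * k) x) A - measure_pmf.prob ?\<pi> A\<bar> \<le> 1 / 4"
    if "x \<in> \<Omega>" for x A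
    using c(3)[OF that, of ?\<pi> k A] k
    by (simp add: bind_stationary_kernel_power is_stationary_stationary_distribution)
  then have "tv_distance \<Omega> (kernel_power K (m * k) x) ?\<pi> \<le> 1 / 4" if "x \<in> \<Omega>" for x
    unfolding tv_distance_def using that finite_states by (subst Max_le_iff) auto
  then have "?d (m * k) \<le> 1 / 4"
    using finite_states states_nonempty by (subst Max_le_iff) auto
  then have "?d (mixing_time \<Omega> K) \<le> 1 / 4"
    unfolding mixing_time_def by (rule LeastI)
  then show ?thesis
    using finite_states states_nonempty assms by (subst (asm) Max_le_iff) auto
qed

lemma mixing_time_ge_of_holding:
  fixes p :: real
  assumes xy: "x \<in> \<Omega>" "y \<in> \<Omega>" "x \<noteq> y"
    and hold: "1 - p \<le> pmf (K x) x" "1 - p \<le> pmf (K y) y" and p: "p \<le> 1"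
  shows "1 / 4 \<le> mixing_time \<Omega> K * p"
proof -
  let ?t = "mixing_time \<Omega> K"
  let ?P = "kernel_power K ?t" and ?\<pi> = "stationary_distribution \<Omega> K"
  have stay: "1 - ?t * p \<le> pmf (?P z) z" if "1 - p \<le> pmf (K z) z" for z
  proof -
    \<comment> \<open>Bernoulli's inequality needs \<open>- p \<ge> -1\<close>, and monotonicity of
      powers needs \<open>1 - p \<ge> 0\<close>; both are \<open>p \<le> 1\<close>.\<close>
    have "1 - ?t * p \<le> (1 - p) ^ ?t"
      using Bernoulli_inequality[of "- p" ?t] p by simp
    also have "\<dots> \<le> pmf (K z) z ^ ?t"
      using that p by (intro power_mono) auto
    also have "\<dots> \<le> pmf (?P z) z"
      by (rule power_pmf_self_le_kernel_power)
    finally show ?thesis .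
  qed
  have "\<bar>pmf (?P z) x - pmf ?\<pi> x\<bar> \<le> tv_distance \<Omega> (?P z) ?\<pi>" for z
    unfolding tv_distance_def using finite_states xy
    by (intro Max_ge) (auto simp: measure_pmf_single intro!: rev_image_eqI[of "{x}"])
  then have close: "\<bar>pmf (?P z) x - pmf ?\<pi> x\<bar> \<le> 1 / 4" if "z \<in> \<Omega>" for z
    using tv_distance_mixing_time_le[OF that] by (meson order.trans)
  \<comment> \<open>The row of \<open>y\<close> keeps mass at least \<open>1 - ?t * p\<close> on
    \<open>y\<close>, hence at most \<open>?t * p\<close> remains for \<open>x\<close>.\<close>
  have "pmf (?P y) x + pmf (?P y) y = measure_pmf.prob (?P y) {x, y}"
    using xy by (simp add: measure_measure_pmf_finite)
  also have "\<dots> \<le> 1"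
    by simp
  finally show ?thesis
    using stay[OF hold(1)] stay[OF hold(2)] close[OF xy(1)] close[OF xy(2)] by linarith
qed

end

section \<open>Logit dynamics\<close>

lemma set_pmf_logit_choice:
  assumes "finite (S i)" "S i \<noteq> {}"
  shows "set_pmf (logit_choice S u \<beta> i x) = S i"
proof -
  have "(\<Sum>z\<in>S i. exp (\<beta> * u i (x(i := z)))) > 0"
    using assms by (intro sum_pos) auto
  then have "logit_prob S u \<beta> i x y \<noteq> 0" for y
    by (simp add: logit_prob_def)
  then show ?thesis
    by (auto simp: set_pmf_iff pmf_logit_choice[of S i, OF assms] split: if_splits)
qed

lemma set_pmf_logit_dynamics:
  assumes "n > 0" "\<And>i. i < n \<Longrightarrow> finite (S i)" "\<And>i. i < n \<Longrightarrow> S i \<noteq> {}"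
  shows "set_pmf (logit_dynamics n S u \<beta> x) = (\<Union>i<n. (\<lambda>y. x(i := y)) ` S i)"
  using assms unfolding logit_dynamics_def
  by (auto simp: set_pmf_of_set set_pmf_logit_choice lessThan_empty_iff)

text \<open>Updating the players \<open>0, \<dots>, n - 1\<close> in turn leads from any profile to any other in
  exactly \<open>n\<close> steps.\<close>

lemma primitive_logit_dynamics:
  assumes "n > 0" "\<And>i. i < n \<Longrightarrow> finite (S i)" "\<And>i. i < n \<Longrightarrow> S i \<noteq> {}"
  shows "primitive_kernel (profiles n S) (logit_dynamics n S u \<beta>) n"
proof
  let ?K = "logit_dynamics n S u \<beta>"
  have supp: "set_pmf (?K x) = (\<Union>i<n. (\<lambda>y. x(i := y)) ` S i)" for x
    using assms by (rule set_pmf_logit_dynamics)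
  show "finite (profiles n S)"
    unfolding profiles_def using assms by (intro finite_PiE) auto
  show "profiles n S \<noteq> {}"
    unfolding profiles_def using assms by (auto simp: PiE_eq_empty_iff)
  show "set_pmf (?K x) \<subseteq> profiles n S" if "x \<in> profiles n S" for x
    using that by (auto simp: supp profiles_def PiE_iff extensional_def split: if_splits)
  show "y \<in> set_pmf (kernel_power ?K n x)" if "x \<in> profiles n S" "y \<in> profiles n S" for x y
  proof -
    \<comment> \<open>After \<open>k\<close> steps the players below \<open>k\<close> have already
      adopted \<open>y\<close>, the others still play \<open>x\<close>.\<close>
    have "(\<lambda>j. if j < k then y j else x j) \<in> set_pmf (kernel_power ?K k x)" if "k \<le> n" for k
      using that
    proof (induction k)
      case (Suc k)
      let ?z = "\<lambda>j. if j < k then y j else x j"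
      have "(\<lambda>j. if j < Suc k then y j else x j) = ?z(k := y k)"
        by (auto simp: less_Suc_eq)
      moreover have "?z(k := y k) \<in> set_pmf (?K ?z)"
        unfolding supp using Suc.prems \<open>y \<in> profiles n S\<close>
        by (intro UN_I[of k]) (auto simp: profiles_def)
      ultimately show ?case
        using Suc by auto
    qed simp
    moreover have "(\<lambda>j. if j < n then y j else x j) = y"
      using that by (auto simp: profiles_def PiE_iff extensional_def)
    ultimately show ?thesis
      by (metis order_refl)
  qed
qed

text \<open>Whichever player is selected, redrawing the current strategy leaves the profile
  unchanged; an average over players of quantities at least \<open>q\<close> is at least
  \<open>q\<close>.\<close>

lemma logit_dynamics_holding_ge:
  assumes "n > 0" and "\<And>i. i < n \<Longrightarrow> q \<le> pmf (logit_choice S u \<beta> i x) (x i)"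
  shows "q \<le> pmf (logit_dynamics n S u \<beta> x) x"
proof -
  let ?B = "\<lambda>i. bind_pmf (logit_choice S u \<beta> i x) (\<lambda>y. return_pmf (x(i := y)))"
  have "q \<le> pmf (?B i) x" if "i < n" for i
    using assms(2)[OF that] pmf_mult_le_pmf_bind[of "logit_choice S u \<beta> i x" "x i"
        "\<lambda>y. return_pmf (x(i := y))" x] by simp
  then have "n * q \<le> (\<Sum>i<n. pmf (?B i) x)"
    using sum_mono[of "{..<n}" "\<lambda>_. q" "\<lambda>i. pmf (?B i) x"] by simp
  moreover have "pmf (logit_dynamics n S u \<beta> x) x = (\<Sum>i<n. pmf (?B i) x) / n"
    unfolding logit_dynamics_def using assms(1)
    by (subst pmf_bind_pmf_of_set) (auto simp: lessThan_empty_iff)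
  ultimately show ?thesis
    using assms(1) by (simp add: pos_le_divide_eq mult.commute)
qed

section \<open>The XOR game\<close>

text \<open>The flip \<open>1 - x i\<close> is truncated subtraction, correct because
  \<open>x i\<close> is 0 or 1. The set of ones gains or loses exactly \<open>i\<close>.\<close>

lemma odd_card_ones_flip:
  fixes x :: "nat \<Rightarrow> nat"
  assumes "i < n" "x i \<in> {0, 1}" and even: "even (card {j\<in>{..<n}. x j = 1})"
  shows "odd (card {j\<in>{..<n}. (x(i := 1 - x i)) j = 1})"
proof (cases "x i = 0")
  case True
  have "{j\<in>{..<n}. (x(i := 1 - x i)) j = 1} = insert i {j\<in>{..<n}. x j = 1}"
    using True assms(1) by auto
  then show ?thesis
    using True even by simp
next
  case False
  have "{j\<in>{..<n}. x j = 1} = insert i {j\<in>{..<n}. (x(i := 1 - x i)) j = 1}"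
    using False assms by auto
  then show ?thesis
    using False even by (simp split: if_splits)
qed

text \<open>Staying at an even profile has utility 0 and weight 1, flipping has utility -1 and
  weight \<open>exp (- \<beta>)\<close>. The result depends neither on \<open>n\<close> nor on the
  player.\<close>

lemma xor_choice_stay:
  assumes "i < n" "x i \<in> {0, 1}" and even: "even (card {j\<in>{..<n}. x j = 1})"
  shows "pmf (logit_choice xor_strategies (xor_utility n) \<beta> i x) (x i) = 1 - 1 / (1 + exp \<beta>)"
proof -
  let ?e = "\<lambda>z. exp (\<beta> * xor_utility n i (x(i := z)))"
  have "xor_utility n i (x(i := x i)) = 0"
    using even by (simp add: xor_utility_def)
  moreover have "xor_utility n i (x(i := 1 - x i)) = -1"
    using odd_card_ones_flip[of i n x, OF assms] by (simp add: xor_utility_def)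
  \<comment> \<open>Naming the two strategies as current and flipped avoids a case distinction on
    \<open>x i\<close>.\<close>
  moreover have "{0, 1} = {x i, 1 - x i}" "x i \<noteq> 1 - x i"
    using assms(2) by auto
  ultimately have "(\<Sum>z\<in>{0, 1}. ?e z) = 1 + exp (- \<beta>)" "?e (x i) = 1"
    by simp_all
  then have "logit_prob xor_strategies (xor_utility n) \<beta> i x (x i) = 1 / (1 + exp (- \<beta>))"
    unfolding logit_prob_def xor_strategies_def by simp
  also have "\<dots> = 1 - 1 / (1 + exp \<beta>)"
  proof -
    have "1 + exp \<beta> \<noteq> 0"
      using exp_gt_zero[of \<beta>] by linarith
    then show ?thesis
      by (simp add: exp_minus divide_simps add_eq_0_iff)
  qed
  finally show ?thesis
    using assms(2) by (subst pmf_logit_choice) (auto simp: xor_strategies_def)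
qed

theorem theorem23:
  "\<exists>C::real. C > 0 \<and>
     (\<forall>n::nat. \<forall>\<beta>::real. n \<ge> 2 \<longrightarrow> \<beta> \<ge> 0 \<longrightarrow>
        real (logit_mixing_time n xor_strategies (xor_utility n) \<beta>) \<ge> C * exp \<beta>)"
proof (intro exI[of _ "1/4"] conjI allI impI)
  fix n :: nat and \<beta> :: real
  assume n: "n \<ge> 2"
  let ?\<Omega> = "profiles n xor_strategies"
  let ?K = "logit_dynamics n xor_strategies (xor_utility n) \<beta>"
  let ?p = "1 / (1 + exp \<beta>)"
  interpret primitive_kernel ?\<Omega> ?K n
    using n by (intro primitive_logit_dynamics) (auto simp: xor_strategies_def)
  have hold: "1 - ?p \<le> pmf (?K x) x"
    if "x \<in> ?\<Omega>" "even (card {j\<in>{..<n}. x j = 1})" for x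
    using n that by (intro logit_dynamics_holding_ge)
      (auto simp: xor_choice_stay profiles_def xor_strategies_def PiE_iff)
  \<comment> \<open>Two distinct even profiles: no ones, and ones for players 0 and 1. The
    assumption \<open>n \<ge> 2\<close> makes room for both ones; a single player has only one even
    profile.\<close>
  define x y :: "nat \<Rightarrow> nat"
    where "x = (\<lambda>j\<in>{..<n}. 0)" and "y = (\<lambda>j\<in>{..<n}. if j < 2 then 1 else 0)"
  have x: "x \<in> ?\<Omega>" and y: "y \<in> ?\<Omega>"
    by (auto simp: x_def y_def profiles_def xor_strategies_def)
  have "x 0 \<noteq> y 0"
    using n by (simp add: x_def y_def)
  then have neq: "x \<noteq> y"
    by metis
  have "{j\<in>{..<n}. x j = 1} = {}" "{j\<in>{..<n}. y j = 1} = {..<2}"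
    using n by (auto simp: x_def y_def split: if_splits)
  then have even: "even (card {j\<in>{..<n}. x j = 1})" "even (card {j\<in>{..<n}. y j = 1})"
    by (simp_all only: card.empty card_lessThan even_numeral even_zero)
  have gt: "1 + exp \<beta> > 1"
    by simp
  then have "?p \<le> 1"
    by (subst divide_le_eq_1_pos) linarith+
  then have "1 / 4 \<le> mixing_time ?\<Omega> ?K * ?p"
    by (rule mixing_time_ge_of_holding[OF x y neq hold[OF x even(1)] hold[OF y even(2)]])
  \<comment> \<open>Dropping the summand 1 from this bound yields the constant
    \<open>1/4\<close>.\<close>
  then have "(1 + exp \<beta>) / 4 \<le> mixing_time ?\<Omega> ?K"
    using gt by (simp add: field_simps)
  then show "1 / 4 * exp \<beta> \<le> logit_mixing_time n xor_strategies (xor_utility n) \<beta>"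
    by (simp add: logit_mixing_time_def)
qed simp

end
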